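(* For every integer $n \geq 3$, $\sigma(\mathrm{GP}(n,1)) = 3$.
   Context: Surrounding Cops and Robbers on a finite simple graph $G$ with $k \geq 1$ cops and one robber: the cops first choose starting vertices (several cops may share a vertex), then the robber chooses a starting vertex not occupied by a cop, and thereafter the cops and the robber alternate moves, the cops moving first. In a move, each player may move to an adjacent vertex or stay put; the robber may never move to, or remain on, a vertex occupied by a cop, so if a cop moves onto the robber's vertex the robber is compelled to move to a neighbouring vertex not occupied by a cop. The cops win if at any time every neighbour of the robber's vertex is occupied by a cop; the robber wins if he avoids this forever. Play is with perfect information. The surrounding cop number $\sigma(G)$ is the least number of cops for which the cops have a winning strategy. $\mathrm{GP}(n,1)$ (the prism) has vertex set $\{a_0,\dots,a_{n-1}\} \cup \{b_0,\dots,b_{n-1}\}$ and edges $\{a_i,a_{i+1}\}$, $\{a_i,b_i\}$, $\{b_i,b_{i+1}\}$ for each $i$, subscripts modulo $n$. *)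

theory Defs
  imports "Graph_Theory.Graph_Theory"
begin

text \<open>
  Finite simple graphs are the graphs of locale \<^locale>\<open>pair_graph\<close>: an undirected edge
  is represented by its two orientations.
\<close>

definition neighbours :: "'a pair_pre_digraph \<Rightarrow> 'a \<Rightarrow> 'a set" where
  "neighbours G v = {w. (v, w) \<in> parcs G}"

definition legal_step :: "'a pair_pre_digraph \<Rightarrow> 'a \<Rightarrow> 'a \<Rightarrow> bool" where
  "legal_step G v w \<longleftrightarrow> w = v \<or> w \<in> neighbours G v"

text \<open>
  A strategy for \<open>k\<close> cops maps the list of all robber positions so far, in chronological order,
  to the cops' positions, with cop \<open>i < k\<close> on vertex \<open>s h i\<close>. Thus \<open>s []\<close> is the
  starting placement and \<open>s [r\<^sub>0, \<dots>, r\<^sub>t]\<close> is the placement that the cops move to when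
  the robber, having been on \<open>r\<^sub>0, \<dots>, r\<^sub>t\<close> in turn, stands on \<open>r\<^sub>t\<close>. The cops' own
  earlier positions are determined by the strategy, so this is no loss of information.
\<close>

type_synonym 'a cop_strategy = "'a list \<Rightarrow> nat \<Rightarrow> 'a"

definition cop_strategy :: "'a pair_pre_digraph \<Rightarrow> nat \<Rightarrow> 'a cop_strategy \<Rightarrow> bool" where
  "cop_strategy G k s \<longleftrightarrow>
     (\<forall>i<k. s [] i \<in> pverts G) \<and>
     (\<forall>h x. \<forall>i<k. legal_step G (s h i) (s (h @ [x]) i))"

text \<open>
  The vertices occupied by the cops just before the robber chooses his \<open>t\<close>-th position
  \<open>r t\<close>; the cops stay there until their next move.
\<close>

definition cops_at :: "nat \<Rightarrow> 'a cop_strategy \<Rightarrow> (nat \<Rightarrow> 'a) \<Rightarrow> nat \<Rightarrow> 'a set" where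
  "cops_at k s r t = s (map r [0..<t]) ` {..<k}"

definition robber_play ::
    "'a pair_pre_digraph \<Rightarrow> nat \<Rightarrow> 'a cop_strategy \<Rightarrow> (nat \<Rightarrow> 'a) \<Rightarrow> bool" where
  "robber_play G k s r \<longleftrightarrow>
     r 0 \<in> pverts G \<and>
     (\<forall>t. legal_step G (r t) (r (Suc t))) \<and>
     (\<forall>t. r t \<notin> cops_at k s r t)"

definition surrounded :: "'a pair_pre_digraph \<Rightarrow> 'a set \<Rightarrow> 'a \<Rightarrow> bool" where
  "surrounded G C v \<longleftrightarrow> neighbours G v \<subseteq> C"

text \<open>
  The two disjuncts are the situations after the robber's and after the cops' turn. Considering
  infinite plays only is no restriction: a robber without a legal move has a cop on every
  neighbouring vertex, hence is surrounded already.
\<close>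

definition winning_cop_strategy ::
    "'a pair_pre_digraph \<Rightarrow> nat \<Rightarrow> 'a cop_strategy \<Rightarrow> bool" where
  "winning_cop_strategy G k s \<longleftrightarrow>
     cop_strategy G k s \<and>
     (\<forall>r. robber_play G k s r \<longrightarrow>
        (\<exists>t. surrounded G (cops_at k s r t) (r t) \<or>
             surrounded G (cops_at k s r (Suc t)) (r t)))"

definition surrounding_cop_number :: "'a pair_pre_digraph \<Rightarrow> nat" where
  "surrounding_cop_number G = (LEAST k. 1 \<le> k \<and> (\<exists>s. winning_cop_strategy G k s))"

datatype prism_vertex = Va nat | Vb nat

definition prism_edges :: "nat \<Rightarrow> prism_vertex rel" where
  "prism_edges n =
     (\<Union>i<n. {(Va i, Va ((i + 1) mod n)), (Va i, Vb i), (Vb i, Vb ((i + 1) mod n))})"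

definition prism :: "nat \<Rightarrow> prism_vertex pair_pre_digraph" where
  "prism n = \<lparr> pverts = Va ` {..<n} \<union> Vb ` {..<n},
               parcs = prism_edges n \<union> (prism_edges n)\<inverse> \<rparr>"

lemma pair_graph_prism:
  assumes "n \<ge> 3"
  shows "pair_graph (prism n)"
proof -
  have ne: "Suc i mod n \<noteq> i" if "i < n" for i
    using that assms by (cases "Suc i = n") auto
  show ?thesis
  proof
    show "symmetric (with_proj (prism n))"
      by (auto simp: symmetric_def prism_def intro!: symI)
    show "finite (parcs (prism n))"
      by (simp add: prism_def prism_edges_def)
    show "fst e \<noteq> snd e" if "e \<in> parcs (prism n)" for e
      using that ne by (fastforce simp: prism_def prism_edges_def)
  qed (use assms in \<open>auto simp: prism_def prism_edges_def\<close>)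
qed

end

theory Submission
  imports Defs
begin

text \<open>
  Two cops never surround a robber in a cubic graph, and he always has a free neighbour to escape to.

  Three cops win on the prism. Unroll it to the infinite ladder \<open>\<int> \<times> {a, b}\<close>. A cop who is on the
  same side as the robber after each cops' turn cannot be passed: the robber could only enter his
  column through the vertex he occupies. Two cops starting on \<open>a\<^sub>0\<close> and \<open>b\<^sub>0\<close> reach such
  positions to the left and to the right of the robber in one turn. When the robber changes sides
  they change sides too; otherwise they close in, as long as there is a column between them
  and the robber. The third cop walks towards the robber's column. As the robber cannot change
  sides once that cop is opposite him, the distance of the two guards, the distance of the third
  cop from the robber's column, and whether he is opposite the robber form a lexicographically
  decreasing measure.
\<close>

section \<open>Escaping from fewer cops than the minimum degree\<close>

text \<open>By pigeonhole, \<open>k\<close> cops always leave a neighbour of the robber's vertex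
  free. Against a given strategy he steps to such a neighbour each time, which yields an infinite
  play in which he is never surrounded.\<close>

lemma no_winning_cop_strategy_if_degree_gt:
  assumes ne: "pverts G \<noteq> {}"
    and nb: "\<And>v. v \<in> pverts G \<Longrightarrow> neighbours G v \<subseteq> pverts G"
    and deg: "\<And>v. v \<in> pverts G \<Longrightarrow> k < card (neighbours G v)"
  shows "\<not> winning_cop_strategy G k s"
proof
  assume win: "winning_cop_strategy G k s"
  have free: "\<exists>w \<in> neighbours G v. w \<notin> c ` {..<k}" if "v \<in> pverts G" for v c
  proof (rule ccontr)
    assume "\<not> ?thesis"
    then have "card (neighbours G v) \<le> card (c ` {..<k})"
      by (intro card_mono) auto
    also have "\<dots> \<le> k"
      using card_image_le[of "{..<k}" c] by simp
    finally show False
      using deg[OF that] by simp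
  qed
  \<comment> \<open>These are the robber's admissible choices after history \<open>h\<close>. His
    start need not be adjacent to anything, hence the condition
    \<open>h \<noteq> []\<close>.\<close>
  define P where "P h w \<longleftrightarrow> w \<in> pverts G \<and> w \<notin> s h ` {..<k} \<and> (h \<noteq> [] \<longrightarrow> legal_step G (last h) w)"
    for h w
  define pick where "pick h = (SOME w. P h w)" for h
  define H where "H = rec_nat [] (\<lambda>_ h. h @ [pick h])"
  define r where "r t = pick (H t)" for t
  have H0: "H 0 = []" and HSuc: "H (Suc t) = H t @ [r t]" for t
    by (simp_all add: H_def r_def)
  have H: "H t = map r [0..<t]" for t
    by (induction t) (simp_all add: H0 HSuc)
  have pick: "P h (pick h)" if "h = [] \<or> last h \<in> pverts G" for h
  proof -
    \<comment> \<open>With an empty history any vertex can stand in for the robber's position: a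
      free neighbour of it is a legal start.\<close>
    have "\<exists>v \<in> pverts G. h \<noteq> [] \<longrightarrow> v = last h"
      using that ne by (cases "h = []") auto
    then obtain v where v: "v \<in> pverts G" "h \<noteq> [] \<longrightarrow> v = last h"
      by blast
    obtain w where "w \<in> neighbours G v" "w \<notin> s h ` {..<k}"
      using free[OF v(1), of "s h"] by blast
    then have "P h w"
      using v nb[OF v(1)] by (auto simp: P_def legal_step_def)
    then show ?thesis
      unfolding pick_def by (rule someI)
  qed
  have P: "P (H t) (r t)" for t
  proof (induction t)
    case 0
    show ?case using pick[of "[]"] by (simp add: r_def H0)
  next
    case (Suc t)
    then have "last (H (Suc t)) \<in> pverts G"
      by (simp add: HSuc P_def)
    then show ?case
      unfolding r_def[of "Suc t"] by (intro pick disjI2)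
  qed
  have rv: "r t \<in> pverts G" for t
    using P[of t] by (simp add: P_def)
  have "robber_play G k s r"
    unfolding robber_play_def cops_at_def
  proof (intro conjI allI)
    show "r 0 \<in> pverts G" by (rule rv)
    show "legal_step G (r t) (r (Suc t))" for t
      using P[of "Suc t"] by (simp add: P_def HSuc)
    show "r t \<notin> s (map r [0..<t]) ` {..<k}" for t
      using P[of t] by (simp add: P_def H)
  qed
  then obtain t where "surrounded G (cops_at k s r t) (r t) \<or> surrounded G (cops_at k s r (Suc t)) (r t)"
    using win by (auto simp: winning_cop_strategy_def)
  then show False
    using free[OF rv[of t]] unfolding surrounded_def cops_at_def by blast
qed

section \<open>Cop strategies from well-founded progress\<close>

text \<open>The third argument of \<open>I\<close> is a memory on which the cops' strategy may depend.\<close>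

lemma winning_cop_strategy_if_wf_progress:
  fixes I :: "(nat \<Rightarrow> 'a) \<Rightarrow> 'a \<Rightarrow> 'm \<Rightarrow> bool"
  assumes wf: "wf W"
    and start: "\<And>i. i < k \<Longrightarrow> c\<^sub>0 i \<in> pverts G"
    and init: "\<And>v. v \<in> pverts G \<Longrightarrow> v \<notin> c\<^sub>0 ` {..<k} \<Longrightarrow>
      \<exists>c m. (\<forall>i<k. legal_step G (c\<^sub>0 i) (c i)) \<and> I c v m"
    and step: "\<And>c v m v'. I c v m \<Longrightarrow> \<not> surrounded G (c ` {..<k}) v \<Longrightarrow>
      legal_step G v v' \<Longrightarrow> v' \<notin> c ` {..<k} \<Longrightarrow>
      \<exists>c' m'. (\<forall>i<k. legal_step G (c i) (c' i)) \<and> I c' v' m' \<and> (m', m) \<in> W"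
  shows "\<exists>s. winning_cop_strategy G k s"
proof -
  define A where "A v q \<longleftrightarrow> (\<forall>i<k. legal_step G (c\<^sub>0 i) (fst q i)) \<and> I (fst q) v (snd q)"
    for v and q :: "(nat \<Rightarrow> 'a) \<times> 'm"
  define B where "B p v q \<longleftrightarrow>
      (\<forall>i<k. legal_step G (fst p i) (fst q i)) \<and> I (fst q) v (snd q) \<and> (snd q, snd p) \<in> W"
    for v and p q :: "(nat \<Rightarrow> 'a) \<times> 'm"
  \<comment> \<open>A strategy must move legally on every history, even one that no robber can
    produce. Where no suitable reply exists, \<open>ini\<close> and \<open>nxt\<close> let the cops
    stay put.\<close>
  define ini where "ini v = (if \<exists>q. A v q then SOME q. A v q else (c\<^sub>0, undefined))" for v
  define nxt where "nxt p v = (if \<exists>q. B p v q then SOME q. B p v q else p)" for p v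
  have ini: "A v (ini v)" if "\<exists>q. A v q" for v
    using that unfolding ini_def by (auto intro: someI_ex)
  have nxt: "B p v (nxt p v)" if "\<exists>q. B p v q" for p v
    using that unfolding nxt_def by (auto intro: someI_ex)
  have legal_ini: "legal_step G (c\<^sub>0 i) (fst (ini v) i)" if "i < k" for i v
  proof (cases "\<exists>q. A v q")
    case True
    then show ?thesis using ini[OF True] that by (simp add: A_def)
  next
    case False
    then have "ini v = (c\<^sub>0, undefined)" unfolding ini_def by (rule if_not_P)
    then show ?thesis by (simp add: legal_step_def)
  qed
  have legal_nxt: "legal_step G (fst p i) (fst (nxt p v) i)" if "i < k" for i p v
  proof (cases "\<exists>q. B p v q")
    case True
    then show ?thesis using nxt[OF True] that by (simp add: B_def)
  next
    case False
    then have "nxt p v = p" unfolding nxt_def by (rule if_not_P)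
    then show ?thesis by (simp add: legal_step_def)
  qed
  \<comment> \<open>A strategy sees only the robber's history, so positions and memory are
    recomputed by folding over it.\<close>
  define s where "s h = (case h of [] \<Rightarrow> c\<^sub>0 | x # xs \<Rightarrow> fst (foldl nxt (ini x) xs))" for h
  have strat: "cop_strategy G k s"
    unfolding cop_strategy_def
  proof (intro conjI allI impI)
    show "s [] i \<in> pverts G" if "i < k" for i
      using start[OF that] by (simp add: s_def)
    show "legal_step G (s h i) (s (h @ [x]) i)" if "i < k" for h x i
      by (cases h) (simp_all add: s_def legal_ini[OF that] legal_nxt[OF that])
  qed
  have "\<exists>t. surrounded G (cops_at k s r t) (r t) \<or> surrounded G (cops_at k s r (Suc t)) (r t)"
    if play: "robber_play G k s r" for r
  proof (rule ccontr)
    assume not_surrounded: "\<not> ?thesis"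
    \<comment> \<open>\<open>S t\<close> is the cops' state after their reply to \<open>r t\<close>,
      hence the shift to \<open>cops_at k s r (Suc t)\<close>. The position \<open>r 0\<close> is
      consumed by \<open>ini\<close>, so the fold starts at index 1.\<close>
    define S where "S t = foldl nxt (ini (r 0)) (map r [Suc 0..<Suc t])" for t
    have SSuc: "S (Suc t) = nxt (S t) (r (Suc t))" for t
      by (simp add: S_def)
    have cops: "cops_at k s r (Suc t) = fst (S t) ` {..<k}" for t
    proof -
      have "map r [0..<Suc t] = r 0 # map r [Suc 0..<Suc t]"
        by (subst upt_conv_Cons) auto
      then show ?thesis
        unfolding cops_at_def s_def S_def by simp
    qed
    have prog: "B (S t) (r (Suc t)) (S (Suc t))" if "I (fst (S t)) (r t) (snd (S t))" for t
    proof -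
      have "\<exists>q. B (S t) (r (Suc t)) q"
        using step[OF that, of "r (Suc t)"] not_surrounded play
        unfolding cops[symmetric] robber_play_def B_def by auto
      then show ?thesis
        unfolding SSuc by (rule nxt)
    qed
    have inv: "I (fst (S t)) (r t) (snd (S t))" for t
    proof (induction t)
      case 0
      have "cops_at k s r 0 = c\<^sub>0 ` {..<k}"
        by (simp add: cops_at_def s_def)
      then have "\<exists>q. A (r 0) q"
        using init[of "r 0"] play unfolding robber_play_def A_def by (metis fst_conv snd_conv)
      then show ?case
        using ini by (simp add: S_def A_def)
    next
      case (Suc t)
      then show ?case using prog by (simp add: B_def)
    qed
    \<comment> \<open>In a play without surrounding, the memories would descend in \<open>W\<close>
      forever.\<close>
    have "(snd (S (Suc t)), snd (S t)) \<in> W" for t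
      using prog[OF inv] by (simp add: B_def)
    then have "\<exists>f. \<forall>t. (f (Suc t), f t) \<in> W"
      by (intro exI[of _ "\<lambda>t. snd (S t)"]) blast
    then show False
      using wf unfolding wf_iff_no_infinite_down_chain by blast
  qed
  with strat show ?thesis
    unfolding winning_cop_strategy_def by blast
qed

section \<open>The prism as a quotient of the infinite ladder\<close>

text \<open>The covering map from the infinite ladder onto the prism.\<close>

definition ladder :: "nat \<Rightarrow> bool \<Rightarrow> int \<Rightarrow> prism_vertex" where
  "ladder n x z = (if x then Va else Vb) (nat (z mod int n))"

lemma ladder_of_nat:
  "i < n \<Longrightarrow> ladder n True (int i) = Va i"
  "i < n \<Longrightarrow> ladder n False (int i) = Vb i"
  by (simp_all add: ladder_def)

lemma ladder_eq_iff:
  assumes "n > 0"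
  shows "ladder n x z = ladder n y w \<longleftrightarrow> x = y \<and> z mod int n = w mod int n"
  using assms by (auto simp: ladder_def nat_eq_iff)

lemma ladder_add_period [simp]: "ladder n x (z + int n) = ladder n x z"
  by (simp add: ladder_def)

lemma pverts_prism_eq:
  assumes "n > 0"
  shows "pverts (prism n) = {ladder n x z | x z. 0 \<le> z \<and> z < int n}"
proof (intro equalityI subsetI)
  fix v assume "v \<in> pverts (prism n)"
  then obtain i where i: "i < n" and "v = Va i \<or> v = Vb i"
    by (auto simp: prism_def)
  then obtain x where "v = ladder n x (int i)"
    using ladder_of_nat[OF i] by metis
  moreover have "0 \<le> int i" "int i < int n"
    using i by simp_all
  ultimately show "v \<in> {ladder n x z | x z. 0 \<le> z \<and> z < int n}"
    by blast
next
  fix v assume "v \<in> {ladder n x z | x z. 0 \<le> z \<and> z < int n}"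
  then show "v \<in> pverts (prism n)"
    using assms by (auto simp: prism_def ladder_def nat_less_iff)
qed

lemma ladder_in_pverts: "n > 0 \<Longrightarrow> ladder n x z \<in> pverts (prism n)"
  by (auto simp: prism_def ladder_def nat_less_iff)

text \<open>Indexing by all integers removes the wrap-around: the edges attached to column
  \<open>z\<close> depend only on \<open>z mod int n\<close>, and these residues exhaust the column
  indices.\<close>

lemma prism_edges_eq:
  assumes "n > 0"
  shows "prism_edges n = (\<Union>z. {(ladder n True z, ladder n True (z + 1)),
    (ladder n True z, ladder n False z), (ladder n False z, ladder n False (z + 1))})"
    (is "_ = (\<Union>z. ?E z)")
proof -
  define F where
    "F i = {(Va i, Va ((i + 1) mod n)), (Va i, Vb i), (Vb i, Vb ((i + 1) mod n))}" for i
  have F: "?E z = F (nat (z mod int n))" for z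
  proof -
    have "nat ((z + 1) mod int n) = (nat (z mod int n) + 1) mod n"
    proof -
      have "(z + 1) mod int n = (int (nat (z mod int n)) + 1) mod int n"
        using assms by (simp add: mod_simps)
      also have "\<dots> = int ((nat (z mod int n) + 1) mod n)"
        by (simp add: zmod_int ac_simps)
      finally show ?thesis by simp
    qed
    then show ?thesis by (simp add: F_def ladder_def)
  qed
  have "range (\<lambda>z. nat (z mod int n)) = {..<n}"
  proof (intro equalityI subsetI)
    fix i assume "i \<in> {..<n}"
    then have "i = nat (int i mod int n)" by simp
    then show "i \<in> range (\<lambda>z. nat (z mod int n))" by blast
  qed (use assms in \<open>auto simp: nat_less_iff\<close>)
  then have "(\<Union>i<n. F i) = (\<Union>z. F (nat (z mod int n)))"
    by (metis image_image)
  then show ?thesis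
    unfolding F by (simp add: prism_edges_def F_def)
qed

lemma neighbours_ladder:
  assumes "n > 0"
  shows "neighbours (prism n) (ladder n x z) =
    {ladder n x (z - 1), ladder n x (z + 1), ladder n (\<not> x) z}"
proof (intro equalityI subsetI)
  fix v assume "v \<in> neighbours (prism n) (ladder n x z)"
  \<comment> \<open>The three edge types and their reversals. Writing \<open>w + 1 - 1\<close>
    presents the end of a reversed edge as the left neighbour of column
    \<open>w + 1\<close>.\<close>
  then consider w where "ladder n x z = ladder n True w" "v = ladder n True (w + 1)"
    | w where "ladder n x z = ladder n True w" "v = ladder n False w"
    | w where "ladder n x z = ladder n False w" "v = ladder n False (w + 1)"
    | w where "ladder n x z = ladder n True (w + 1)" "v = ladder n True (w + 1 - 1)"
    | w where "ladder n x z = ladder n False w" "v = ladder n True w"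
    | w where "ladder n x z = ladder n False (w + 1)" "v = ladder n False (w + 1 - 1)"
    unfolding neighbours_def prism_def prism_edges_eq[OF assms] by auto
  then obtain y w where yw: "ladder n x z = ladder n y w"
    and v: "v \<in> {ladder n y (w - 1), ladder n y (w + 1), ladder n (\<not> y) w}"
    by cases (erule that, simp)+
  \<comment> \<open>A vertex fixes its column only modulo \<open>n\<close>, so the neighbours found
    at \<open>w\<close> must be carried over to \<open>z\<close>.\<close>
  have xy: "x = y" and mod: "z mod int n = w mod int n"
    using yw assms by (simp_all add: ladder_eq_iff)
  have "(z + 1) mod int n = (w + 1) mod int n"
    using mod by (rule mod_add_cong) simp
  moreover have "(z - 1) mod int n = (w - 1) mod int n"
    using mod by (rule mod_diff_cong) simp
  ultimately show "v \<in> {ladder n x (z - 1), ladder n x (z + 1), ladder n (\<not> x) z}"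
    using v mod by (simp add: xy ladder_def)
next
  fix v assume "v \<in> {ladder n x (z - 1), ladder n x (z + 1), ladder n (\<not> x) z}"
  moreover have "z = z - 1 + 1" by simp
  ultimately show "v \<in> neighbours (prism n) (ladder n x z)"
    unfolding neighbours_def prism_def prism_edges_eq[OF assms]
    by (cases x; simp; metis)
qed

lemma card_neighbours_prism:
  assumes "n \<ge> 3" "v \<in> pverts (prism n)"
  shows "card (neighbours (prism n) v) = 3"
proof -
  have n: "n > 0" using assms by simp
  obtain x z where v: "v = ladder n x z"
    using assms(2) pverts_prism_eq[OF n] by auto
  \<comment> \<open>The left and right neighbours differ because \<open>n \<ge> 3\<close> does not
    divide 2.\<close>
  have "(z - 1) mod int n \<noteq> (z + 1) mod int n"
  proof
    assume "(z - 1) mod int n = (z + 1) mod int n"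
    then have "int n dvd (z + 1) - (z - 1)" by (metis mod_eq_dvd_iff)
    then show False using assms(1) by (auto dest: zdvd_imp_le)
  qed
  then show ?thesis
    unfolding v neighbours_ladder[OF n] using n by (auto simp: ladder_eq_iff)
qed

lemma legal_step_ladder:
  assumes "n > 0"
  shows "legal_step (prism n) (ladder n x z) v \<longleftrightarrow>
    v \<in> {ladder n x z, ladder n x (z - 1), ladder n x (z + 1), ladder n (\<not> x) z}"
  by (simp add: legal_step_def neighbours_ladder[OF assms])

section \<open>Three cops on the prism\<close>

lemma three_cops_win_prism:
  assumes "n > 0"
  shows "\<exists>s. winning_cop_strategy (prism n) 3 s"
proof -
  define cop where "cop x l r y m =
    (\<lambda>i::nat. if i = 0 then ladder n x l else if i = 1 then ladder n x r else ladder n y m)"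
    for x l r y m
  \<comment> \<open>The memory lifts the position to the ladder: robber at \<open>(x, p)\<close>,
    guards at \<open>(x, l)\<close> and \<open>(x, r)\<close>, third cop at \<open>(y, m)\<close>.
    Left and right of the robber have no meaning on the cyclic prism itself.\<close>
  define I where "I c v = (\<lambda>(x, p, l, r, y, m). l < p \<and> p < r \<and>
    c = cop x l r y m \<and> v = ladder n x p)" for c v
  define W where "W = measures
    [\<lambda>(x::bool, p, l, r, y, m). nat (r - l),
     \<lambda>(x, p, l, r, y, m). nat \<bar>m - p\<bar>,
     \<lambda>(x, p, l, r, y, m). if m = p \<and> y \<noteq> x then 0 else 1]"
  have image_cop: "cop x l r y m ` {..<3} = {ladder n x l, ladder n x r, ladder n y m}" for x l r y m
    by (auto simp: cop_def numeral_3_eq_3 lessThan_Suc)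
  have legal_cop: "\<forall>i<3. legal_step (prism n) (cop x l r y m i) (cop x' l' r' y' m' i)"
    if "legal_step (prism n) (ladder n x l) (ladder n x' l')"
      "legal_step (prism n) (ladder n x r) (ladder n x' r')"
      "legal_step (prism n) (ladder n y m) (ladder n y' m')" for x l r y m x' l' r' y' m'
    using that by (simp add: cop_def)
  define c\<^sub>0 where "c\<^sub>0 = (\<lambda>i::nat. if i = 0 then ladder n True 0 else ladder n False 0)"
  show ?thesis
  proof (rule winning_cop_strategy_if_wf_progress[of W 3 c\<^sub>0 _ I])
    show "wf W" by (simp add: W_def)
    show "c\<^sub>0 i \<in> pverts (prism n)" if "i < 3" for i
      using ladder_in_pverts[OF assms] by (simp add: c\<^sub>0_def)
  next
    fix v assume v: "v \<in> pverts (prism n)" "v \<notin> c\<^sub>0 ` {..<3}"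
    then obtain x z where z: "v = ladder n x z" "0 \<le> z" "z < int n"
      using pverts_prism_eq[OF assms] by auto
    have "c\<^sub>0 ` {..<3} = {ladder n True 0, ladder n False 0}"
      by (auto simp: c\<^sub>0_def numeral_3_eq_3 lessThan_Suc)
    with v z have "z \<noteq> 0" by (cases x) auto
    \<comment> \<open>Both guards stand on the same vertex, but the second is lifted to column
      \<open>int n\<close>, so the two lifts enclose the robber. Only the guard starting on the
      other side has to move.\<close>
    then have "I (cop x 0 (int n) False 0) v (x, z, 0, int n, False, 0)"
      using z by (simp add: I_def)
    moreover have "\<forall>i<3. legal_step (prism n) (c\<^sub>0 i) (cop x 0 (int n) False 0 i)"
      using ladder_add_period[of n x 0]
      by (cases x) (auto simp: c\<^sub>0_def cop_def legal_step_ladder[OF assms])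
    ultimately show "\<exists>c m. (\<forall>i<3. legal_step (prism n) (c\<^sub>0 i) (c i)) \<and> I c v m"
      by blast
  next
    fix c v k v'
    assume I: "I c v k" and not_surrounded: "\<not> surrounded (prism n) (c ` {..<3}) v"
      and move: "legal_step (prism n) v v'" and free: "v' \<notin> c ` {..<3}"
    obtain x p l r y m where k: "k = (x, p, l, r, y, m)"
      by (cases k)
    have c: "c = cop x l r y m" and v: "v = ladder n x p" and lpr: "l < p" "p < r"
      using I by (auto simp: I_def k)
    have free': "v' \<noteq> ladder n x l" "v' \<noteq> ladder n x r" "v' \<noteq> ladder n y m"
      using free by (auto simp: c image_cop)
    have walk: "legal_step (prism n) (ladder n y m) (ladder n y (m + sgn d))" for d
      by (auto simp: sgn_if legal_step_ladder[OF assms])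
    have "v' = ladder n (\<not> x) p \<or> (\<exists>q \<in> {p, p - 1, p + 1}. v' = ladder n x q)"
      using move unfolding v legal_step_ladder[OF assms] by auto
    then show "\<exists>c' k'. (\<forall>i<3. legal_step (prism n) (c i) (c' i)) \<and> I c' v' k' \<and> (k', k) \<in> W"
    proof (elim disjE bexE)
      assume v': "v' = ladder n (\<not> x) p"
      let ?m = "m + sgn (p - m)"
      have "I (cop (\<not> x) l r y ?m) v' (\<not> x, p, l, r, y, ?m)"
        using lpr v' by (simp add: I_def)
      moreover have "\<forall>i<3. legal_step (prism n) (c i) (cop (\<not> x) l r y ?m i)"
        unfolding c by (intro legal_cop walk) (simp_all add: legal_step_ladder[OF assms])
      \<comment> \<open>A third cop opposite the robber would occupy \<open>v'\<close>. So a third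
        cop in column \<open>p\<close> shares the robber's old side and is opposite him after the
        crossing, which lowers the last measure; otherwise his distance drops.\<close>
      moreover have "m = p \<Longrightarrow> y = x"
        using free' v' by (cases x; cases y) simp_all
      then have "((\<not> x, p, l, r, y, ?m), k) \<in> W"
        by (auto simp: W_def k sgn_if)
      ultimately show ?thesis by blast
    next
      fix q assume q: "q \<in> {p, p - 1, p + 1}" and v': "v' = ladder n x q"
      have "q \<noteq> l" "q \<noteq> r"
        using free' v' by auto
      then have lqr: "l < q" "q < r"
        using q lpr by auto
      let ?m = "m + sgn (q - m)"
      let ?l = "if l + 1 < q then l + 1 else l"
      let ?r = "if q < r - 1 then r - 1 else r"
      have "I (cop x ?l ?r y ?m) v' (x, q, ?l, ?r, y, ?m)"
        using lqr v' by (simp add: I_def)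
      moreover have "\<forall>i<3. legal_step (prism n) (c i) (cop x ?l ?r y ?m i)"
        unfolding c by (intro legal_cop walk) (simp_all add: legal_step_ladder[OF assms])
      moreover have "((x, q, ?l, ?r, y, ?m), k) \<in> W"
      proof (cases "l + 1 < q \<or> q < r - 1")
        case True
        then show ?thesis using lqr by (auto simp: W_def k)
      next
        case False
        \<comment> \<open>If neither guard can advance, only one column is left between them, so the
          robber has stayed put.\<close>
        then have eqs: "l = p - 1" "r = p + 1" "q = p"
          using lqr lpr by auto
        have "m \<noteq> p"
        proof
          assume "m = p"
          \<comment> \<open>On side \<open>x\<close> the third cop would stand on the robber's
            vertex, where he may not remain. Opposite him, that cop completes the
            surrounding.\<close>
          then have "y = (\<not> x)"
            using free' v' eqs by (cases x; cases y) simp_all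
          then have "surrounded (prism n) (c ` {..<3}) v"
            unfolding surrounded_def v c image_cop neighbours_ladder[OF assms]
            using eqs \<open>m = p\<close> by auto
          then show False
            using not_surrounded by simp
        qed
        then show ?thesis
          using eqs by (auto simp: W_def k sgn_if)
      qed
      ultimately show ?thesis by blast
    qed
  qed
qed

theorem theorem28:
  fixes n :: nat
  assumes "n \<ge> 3"
  shows "surrounding_cop_number (prism n) = 3"
  unfolding surrounding_cop_number_def
proof (rule Least_equality)
  show "1 \<le> (3::nat) \<and> (\<exists>s. winning_cop_strategy (prism n) 3 s)"
    using three_cops_win_prism[of n] assms by simp
next
  fix k assume k: "1 \<le> k \<and> (\<exists>s. winning_cop_strategy (prism n) k s)"
  have n: "n > 0" using assms by simp
  show "3 \<le> k"
  proof (rule ccontr)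
    assume "\<not> 3 \<le> k"
    have "\<not> winning_cop_strategy (prism n) k s" for s
    proof (rule no_winning_cop_strategy_if_degree_gt)
      show "pverts (prism n) \<noteq> {}"
        using ladder_in_pverts[OF n] by blast
      show "neighbours (prism n) v \<subseteq> pverts (prism n)" if "v \<in> pverts (prism n)" for v
        using that ladder_in_pverts[OF n] by (auto simp: pverts_prism_eq[OF n] neighbours_ladder[OF n])
      show "k < card (neighbours (prism n) v)" if "v \<in> pverts (prism n)" for v
        using card_neighbours_prism[OF assms that] \<open>\<not> 3 \<le> k\<close> by simp
    qed
    then show False using k by blast
  qed
qed

end
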